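(* Let $(\Omega,\mathcal{F},\mathbb{P};\, Z(\omega,s),\, s\in D)$ be a Gaussian process with trajectories in a separable reproducing kernel Hilbert space $\mathcal{H}$ of functions over a compact metric space $D$. Let $\Phi:\Omega\to\mathcal{H}$, $\Phi(\omega) = Z(\omega,\cdot)$. Then the induced measure $$\mu_Z := \mathbb{P}\circ\Phi^{-1}$$ is well-defined as a Borel measure on $\mathcal{H}$ and is Gaussian.
   Context: A Gaussian process on $D$ is a real-valued stochastic process $(Z_s)_{s\in D}$ such that for any finitely many $s_1,\dots,s_n\in D$ the vector $(Z_{s_1},\dots,Z_{s_n})$ is Gaussian (possibly degenerate). A Gaussian measure on a separable Banach space $X$ is a Borel probability measure $\mu$ on $X$ such that for every $\ell\in X^*$ the pushforward $\mu\circ\ell^{-1}$ is Gaussian (possibly degenerate) on $\mathbb{R}$. A reproducing kernel Hilbert space over $D$ is a Hilbert space of real-valued functions on $D$ for which all evaluation functionals are continuous. *)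

theory Defs
  imports "HOL-Probability.Probability"
begin

definition gaussian_real :: "real measure \<Rightarrow> bool" where
  "gaussian_real \<nu> \<longleftrightarrow>
     (\<exists>m. \<nu> = return borel m) \<or>
     (\<exists>m \<sigma>. \<sigma> > 0 \<and> \<nu> = density lborel (normal_density m \<sigma>))"

(* A random vector with values in R^n, given by its coordinates X 0, ..., X (n - 1), is Gaussian
   (possibly degenerate) iff all linear functionals of it are. *)
definition gaussian_vector :: "'w measure \<Rightarrow> nat \<Rightarrow> (nat \<Rightarrow> 'w \<Rightarrow> real) \<Rightarrow> bool" where
  "gaussian_vector M n X \<longleftrightarrow>
     (\<forall>i<n. X i \<in> borel_measurable M) \<and>
     (\<forall>c. gaussian_real (distr M borel (\<lambda>\<omega>. \<Sum>i<n. c i * X i \<omega>)))"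

definition gaussian_process :: "'w measure \<Rightarrow> 'd set \<Rightarrow> ('w \<Rightarrow> 'd \<Rightarrow> real) \<Rightarrow> bool" where
  "gaussian_process M D Z \<longleftrightarrow>
     prob_space M \<and>
     (\<forall>n s. (\<forall>i<n. s i \<in> D) \<longrightarrow> gaussian_vector M n (\<lambda>i \<omega>. Z \<omega> (s i)))"

definition gaussian_measure :: "'b::{banach,second_countable_topology} measure \<Rightarrow> bool" where
  "gaussian_measure \<mu> \<longleftrightarrow>
     sets \<mu> = sets borel \<and> prob_space \<mu> \<and>
     (\<forall>l :: 'b \<Rightarrow> real. bounded_linear l \<longrightarrow> gaussian_real (distr \<mu> borel l))"

(* The elements of a Hilbert space of functions on D are the elements of a type 'h, and app h is
   the function on D that h stands for; only its values on D matter.  Linearity says that the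
   vector space operations are the pointwise ones, and the last conjunct that an element is
   determined by its function on D. *)
definition rkhs :: "'d set \<Rightarrow> ('h::{real_inner,banach} \<Rightarrow> 'd \<Rightarrow> real) \<Rightarrow> bool" where
  "rkhs D app \<longleftrightarrow>
     (\<forall>s\<in>D. linear (\<lambda>h. app h s)) \<and>
     (\<forall>s\<in>D. continuous_on UNIV (\<lambda>h. app h s)) \<and>
     (\<forall>g h. (\<forall>s\<in>D. app g s = app h s) \<longrightarrow> g = h)"

definition in_function_space :: "'d set \<Rightarrow> ('h \<Rightarrow> 'd \<Rightarrow> real) \<Rightarrow> ('d \<Rightarrow> real) \<Rightarrow> bool" where
  "in_function_space D app f \<longleftrightarrow> (\<exists>h. \<forall>s\<in>D. app h s = f s)"

definition path_map :: "'d set \<Rightarrow> ('h \<Rightarrow> 'd \<Rightarrow> real) \<Rightarrow> ('w \<Rightarrow> 'd \<Rightarrow> real) \<Rightarrow> 'w \<Rightarrow> 'h" where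
  "path_map D app Z \<omega> = (THE h. \<forall>s\<in>D. app h s = Z \<omega> s)"

lemma path_map_eval:
  assumes "rkhs D app" "in_function_space D app (Z \<omega>)" "s \<in> D"
  shows "app (path_map D app Z \<omega>) s = Z \<omega> s"
proof -
  obtain h where h: "\<forall>s\<in>D. app h s = Z \<omega> s"
    using assms(2) unfolding in_function_space_def by blast
  have "path_map D app Z \<omega> = h"
    unfolding path_map_def
  proof (rule the_equality)
    show "\<forall>s\<in>D. app h s = Z \<omega> s" by (rule h)
  next
    fix g assume g: "\<forall>s\<in>D. app g s = Z \<omega> s"
    have "\<forall>s\<in>D. app g s = app h s" using g h by simp
    with assms(1) show "g = h" unfolding rkhs_def by blast
  qed
  then show ?thesis using h assms(3) by simp
qed

end

theory Submission
  imports Defs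
begin

text \<open>
  By the Riesz theorem every evaluation \<open>h \<mapsto> app h s\<close> is the inner product with a vector
  \<open>k s\<close>.  An element orthogonal to all \<open>k s\<close> vanishes on \<open>D\<close> and hence is zero, so the
  span of the \<open>k s\<close> is dense (\<open>dense_span_if_separating\<close>).  For \<open>z\<close> in that span the real
  random variable \<open>\<langle>z, \<Phi>\<rangle>\<close> is a finite linear combination of values \<open>Z \<omega> s\<close>, thus Gaussian;
  for an arbitrary \<open>z\<close> it is a pointwise limit of such variables.  It is therefore measurable,
  and it is Gaussian because Gaussian laws are stable under pointwise limits, degenerate laws
  included (\<open>gaussian_real_pointwise_limit\<close>).

  Both claims follow.  In a separable space closed balls are countable intersections of half-spaces,
  so measurability of all \<open>\<langle>z, \<Phi>\<rangle>\<close> gives Borel measurability of \<open>\<Phi>\<close>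
  (\<open>borel_measurable_if_inner_measurable\<close>).  Every continuous linear functional is some
  \<open>\<langle>z, \<cdot>\<rangle>\<close>, so its law under \<open>\<mu>\<^sub>Z\<close> is the law of \<open>\<langle>z, \<Phi>\<rangle>\<close>.

  Stability under limits rests on characteristic functions.  A pointwise convergent sequence is
  pointwise bounded, which makes its characteristic functions uniformly close to \<open>1\<close> near \<open>0\<close>;
  for normal laws this bounds the means and the standard deviations.  Along a subsequence the
  parameters converge, and so do the characteristic functions, to those of a normal law; by
  uniqueness it is the law of the limit.
\<close>

section \<open>Projections, Riesz representation and density in Hilbert spaces\<close>

text \<open>
  The nearest point to \<open>x\<close> exists in \<open>closure S\<close> because a minimising sequence in \<open>S\<close> is Cauchy.
  With the projection taken in the closure, the lemma applies directly to the span of a set.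
\<close>

lemma ex_orthogonal_projection_closure:
  fixes S :: "'a::{real_inner,banach} set"
  assumes S: "subspace S"
  obtains p where "p \<in> closure S" "\<And>y. y \<in> S \<Longrightarrow> inner (x - p) y = 0"
proof -
  define d where "d = infdist x S"
  have ne: "S \<noteq> {}" using subspace_0[OF S] by auto
  have d0: "d \<ge> 0" by (simp add: d_def infdist_nonneg)
  have dle: "d\<^sup>2 \<le> (norm (x - y))\<^sup>2" if "y \<in> S" for y
    using infdist_le[OF that, of x] d0 by (auto simp: d_def dist_norm intro!: power_mono)
  have "\<exists>y\<in>S. (norm (x - y))\<^sup>2 < d\<^sup>2 + e" if "e > 0" for e :: real
  proof -
    have "d < sqrt (d\<^sup>2 + e)" using that by (intro real_less_rsqrt) simp
    then have "\<exists>y\<in>S. dist x y < sqrt (d\<^sup>2 + e)"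
      unfolding d_def by (subst (asm) (1) infdist_notempty[OF ne])
        (auto simp: cINF_less_iff ne bdd_below_image_dist)
    then obtain y where y: "y \<in> S" "dist x y < sqrt (d\<^sup>2 + e)" by blast
    then have "(dist x y)\<^sup>2 < (sqrt (d\<^sup>2 + e))\<^sup>2"
      by (intro power_strict_mono) auto
    then show ?thesis using y that by (auto simp: dist_norm)
  qed
  then have "\<forall>n. \<exists>y\<in>S. (norm (x - y))\<^sup>2 < d\<^sup>2 + 1 / real (Suc n)" by simp
  then obtain y where yS: "\<And>n. y n \<in> S"
    and y: "\<And>n. (norm (x - y n))\<^sup>2 < d\<^sup>2 + 1 / real (Suc n)" by metis
  \<comment> \<open>The midpoint of two near-minimisers lies in \<open>S\<close>, so the parallelogram identity bounds
    their distance.\<close>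
  have close: "(norm (y m - y n))\<^sup>2 < 2 / real (Suc m) + 2 / real (Suc n)" for m n
  proof -
    have "(norm (y m - y n))\<^sup>2 =
        2 * (norm (x - y m))\<^sup>2 + 2 * (norm (x - y n))\<^sup>2
        - 4 * (norm (x - (1/2) *\<^sub>R (y m + y n)))\<^sup>2"
      unfolding power2_norm_eq_inner
      by (simp add: inner_diff inner_add inner_commute algebra_simps)
    moreover have "(1/2) *\<^sub>R (y m + y n) \<in> S"
      by (intro subspace_scale subspace_add S yS)
    ultimately show ?thesis using y[of m] y[of n] dle by fastforce
  qed
  have "Cauchy y"
  proof (rule metric_CauchyI)
    fix e :: real assume e: "e > 0"
    then obtain N where N: "inverse (real (Suc N)) < e\<^sup>2 / 4"
      using reals_Archimedean[of "e\<^sup>2 / 4"] by auto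
    have "dist (y m) (y n) < e" if "m \<ge> N" "n \<ge> N" for m n
    proof -
      have "2 / real (Suc m) \<le> 2 / real (Suc N)" "2 / real (Suc n) \<le> 2 / real (Suc N)"
        using that by (auto intro!: divide_left_mono)
      moreover have "4 / real (Suc N) < e\<^sup>2" using N by (simp add: field_simps)
      ultimately have "(norm (y m - y n))\<^sup>2 < e\<^sup>2"
        using close[of m n] by linarith
      then show ?thesis using e by (simp add: dist_norm power2_less_imp_less)
    qed
    then show "\<exists>N. \<forall>m\<ge>N. \<forall>n\<ge>N. dist (y m) (y n) < e" by blast
  qed
  then obtain p where p: "y \<longlonglongrightarrow> p" using Cauchy_convergent convergent_def by blast
  have "(\<lambda>n. (norm (x - y n))\<^sup>2) \<longlonglongrightarrow> (norm (x - p))\<^sup>2" by (intro tendsto_intros p)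
  moreover have "(\<lambda>n. d\<^sup>2 + 1 / real (Suc n)) \<longlonglongrightarrow> d\<^sup>2 + 0"
    by (intro tendsto_intros LIMSEQ_Suc[OF lim_1_over_n])
  ultimately have pd: "(norm (x - p))\<^sup>2 \<le> d\<^sup>2"
    using y less_imp_le by (simp only: add_0_right) (rule LIMSEQ_le, assumption+, blast)
  have orth: "inner (x - p) v = 0" if v: "v \<in> S" for v
  proof (cases "v = 0")
    case False
    \<comment> \<open>This \<open>t\<close> minimises the distance from \<open>x\<close> to \<open>p + t *\<^sub>R v\<close>.\<close>
    define t where "t = inner (x - p) v / inner v v"
    have "(\<lambda>n. (norm (x - (y n + t *\<^sub>R v)))\<^sup>2) \<longlonglongrightarrow> (norm (x - (p + t *\<^sub>R v)))\<^sup>2"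
      by (intro tendsto_intros p)
    then have "d\<^sup>2 \<le> (norm (x - (p + t *\<^sub>R v)))\<^sup>2"
      by (rule Lim_bounded2) (auto intro!: dle subspace_add subspace_scale S yS v)
    also have "\<dots> = (norm (x - p))\<^sup>2 - (inner (x - p) v)\<^sup>2 / inner v v"
      using False unfolding power2_norm_eq_inner t_def
      by (simp add: inner_diff inner_add inner_commute algebra_simps power2_eq_square
           divide_simps)
    finally have "(inner (x - p) v)\<^sup>2 / inner v v \<le> 0" using pd by linarith
    then show ?thesis using False
      by (metis divide_eq_0_iff inner_eq_zero_iff inner_ge_zero nle_le
          power_zero_numeral zero_le_divide_iff zero_le_power2 power_eq_0_iff)
  qed simp
  have "p \<in> closure S" using p yS by (auto simp: closure_sequential)
  then show ?thesis using that orth by blast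
qed

text \<open>
  The kernel of a nonzero functional is a closed hyperplane; its normal vector, suitably scaled,
  represents the functional.
\<close>

lemma ex_riesz_representer:
  fixes f :: "'a::{real_inner,banach} \<Rightarrow> real"
  assumes f: "linear f" "continuous_on UNIV f"
  shows "\<exists>z. \<forall>x. f x = inner z x"
proof (cases "\<forall>x. f x = 0")
  case True
  then show ?thesis by (intro exI[of _ 0]) simp
next
  case False
  interpret linear f by fact
  obtain u where u: "f u \<noteq> 0" using False by blast
  define S where "S = {x. f x = 0}"
  have "subspace S" by (simp add: subspace_def S_def zero add scale)
  then obtain p where p: "p \<in> closure S" and orth: "\<And>y. y \<in> S \<Longrightarrow> inner (u - p) y = 0"
    using ex_orthogonal_projection_closure[of S u] by metis
  have "closed S" unfolding S_def
    using f(2) by (intro closed_Collect_eq) (auto intro: continuous_intros)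
  then have "f p = 0" using p by (simp add: closure_closed S_def)
  define w where "w = u - p"
  have fw: "f w \<noteq> 0" using u \<open>f p = 0\<close> by (simp add: w_def diff)
  then have w: "inner w w \<noteq> 0" by (auto simp: zero)
  have "f x = inner ((f w / inner w w) *\<^sub>R w) x" for x
  proof -
    have "x - (f x / f w) *\<^sub>R w \<in> S" using fw by (simp add: S_def diff scale)
    from orth[OF this] have "inner w x = f x / f w * inner w w"
      by (simp add: w_def inner_diff_right)
    then show ?thesis using fw w by simp
  qed
  then show ?thesis by blast
qed

lemma dense_span_if_separating:
  fixes B :: "'a::{real_inner,banach} set"
  assumes "\<And>w. (\<And>b. b \<in> B \<Longrightarrow> inner b w = 0) \<Longrightarrow> w = 0"
  shows "closure (span B) = UNIV"
proof -
  have "x \<in> closure (span B)" for x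
  proof -
    obtain p where p: "p \<in> closure (span B)" "\<And>y. y \<in> span B \<Longrightarrow> inner (x - p) y = 0"
      using ex_orthogonal_projection_closure[OF subspace_span] by metis
    have "x - p = 0"
      by (rule assms) (use p(2) span_base inner_commute in metis)
    then show ?thesis using p(1) by simp
  qed
  then show ?thesis by blast
qed

text \<open>
  Indexing by an initial segment of the natural numbers matches the form of the linear combinations
  in \<open>gaussian_vector\<close>.
\<close>

lemma span_image_finite_sum:
  fixes k :: "'d \<Rightarrow> 'a::real_vector"
  assumes "z \<in> span (k ` D)"
  shows "\<exists>n c s. (\<forall>i<n. s i \<in> D) \<and> z = (\<Sum>i<(n::nat). c i *\<^sub>R k (s i))"
proof -
  obtain t r where t: "finite t" "t \<subseteq> k ` D" "z = (\<Sum>a\<in>t. r a *\<^sub>R a)"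
    using assms unfolding span_explicit by blast
  obtain h where h: "bij_betw h {..<card t} t"
    using ex_bij_betw_nat_finite[OF t(1)] by (auto simp: atLeast0LessThan)
  have "\<forall>i. \<exists>s. i < card t \<longrightarrow> s \<in> D \<and> k s = h i"
    using t(2) bij_betwE[OF h] by (metis imageE lessThan_iff subsetD)
  then obtain s where s: "\<And>i. i < card t \<Longrightarrow> s i \<in> D \<and> k (s i) = h i" by metis
  have "z = (\<Sum>i<card t. r (h i) *\<^sub>R k (s i))"
    unfolding t(3) using s by (subst sum.reindex_bij_betw[OF h, symmetric]) auto
  then show ?thesis using s by (intro exI[of _ "card t"] exI[of _ "\<lambda>i. r (h i)"] exI[of _ s]) auto
qed

section \<open>Weak measurability implies measurability\<close>

text \<open>
  By Cauchy-Schwarz, a point lies in a closed ball iff it satisfies the half-space condition imposed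
  by each direction \<open>y\<close>.  It suffices to let \<open>y\<close> range over a countable dense set, as the
  condition is closed in \<open>y\<close>.  So preimages of closed balls are measurable, and separability passes
  from balls to open sets.
\<close>

lemma borel_measurable_if_inner_measurable:
  fixes X :: "'w \<Rightarrow> 'a::{real_inner,second_countable_topology}"
  assumes X[measurable]: "\<And>z. (\<lambda>\<omega>. inner z (X \<omega>)) \<in> borel_measurable M"
  shows "X \<in> borel_measurable M"
proof -
  obtain Y :: "'a set" where Y: "countable Y" "\<And>U. open U \<Longrightarrow> U \<noteq> {} \<Longrightarrow> \<exists>y\<in>Y. y \<in> U"
    using countable_dense_exists by blast
  have clY: "closure Y = UNIV"
    using Y(2)[OF open_ball] by (fastforce simp: closure_approachable dist_commute)
  have cball: "v \<in> cball x r \<longleftrightarrow> (\<forall>y\<in>Y. inner y v \<le> inner y x + r * norm y)"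
    if "r \<ge> 0" for v x :: 'a and r
  proof
    assume "v \<in> cball x r"
    then have nv: "norm (v - x) \<le> r" by (simp add: dist_norm norm_minus_commute)
    show "\<forall>y\<in>Y. inner y v \<le> inner y x + r * norm y"
    proof
      fix y
      have "inner y (v - x) \<le> norm y * norm (v - x)" by (rule norm_cauchy_schwarz)
      also have "\<dots> \<le> norm y * r" using nv by (intro mult_left_mono) auto
      finally show "inner y v \<le> inner y x + r * norm y"
        by (simp add: inner_diff_right mult.commute)
    qed
  next
    assume *: "\<forall>y\<in>Y. inner y v \<le> inner y x + r * norm y"
    have "closed {y. inner y v \<le> inner y x + r * norm y}"
      by (intro closed_Collect_le continuous_intros)
    then have "closure Y \<subseteq> {y. inner y v \<le> inner y x + r * norm y}"
      using * by (intro closure_minimal) auto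
    \<comment> \<open>The direction \<open>y = v - x\<close> gives equality in Cauchy-Schwarz.\<close>
    then have "inner (v - x) v \<le> inner (v - x) x + r * norm (v - x)" using clY by auto
    then have "inner (v - x) (v - x) \<le> r * norm (v - x)"
      unfolding inner_diff_right[of "v - x" v x] by linarith
    then have "norm (v - x) * norm (v - x) \<le> r * norm (v - x)"
      by (simp flip: power2_norm_eq_inner power2_eq_square)
    then have "norm (v - x) \<le> r" using that by (cases "norm (v - x) = 0") auto
    then show "v \<in> cball x r" by (simp add: dist_norm norm_minus_commute)
  qed
  have cball_meas: "X -` cball x r \<inter> space M \<in> sets M" if "r \<ge> 0" for x r
  proof -
    have "X -` cball x r \<inter> space M =
        {\<omega>\<in>space M. \<forall>y\<in>Y. inner y (X \<omega>) \<le> inner y x + r * norm y}"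
      using cball[OF that] by auto
    also have "\<dots> \<in> sets M" using Y(1) by measurable
    finally show ?thesis .
  qed
  obtain C :: "'a set" where C: "topological_basis (case_prod ball ` (C \<times> (\<rat> \<inter> {0<..})))" "countable C"
    using balls_countable_basis by blast
  have ball_meas: "X -` ball x r \<inter> space M \<in> sets M" for x r
  proof -
    have "X -` ball x r \<inter> space M = {\<omega>\<in>space M. \<exists>q\<in>\<rat> \<inter> {0..<r}. X \<omega> \<in> cball x q}"
    proof (intro set_eqI iffI)
      fix \<omega> assume "\<omega> \<in> X -` ball x r \<inter> space M"
      moreover from this obtain q where "q \<in> \<rat>" "dist x (X \<omega>) < q" "q < r"
        using Rats_dense_in_real[of "dist x (X \<omega>)" r] by auto
      ultimately show "\<omega> \<in> {\<omega>\<in>space M. \<exists>q\<in>\<rat> \<inter> {0..<r}. X \<omega> \<in> cball x q}"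
        by (auto intro!: bexI[of _ q] order_trans[OF zero_le_dist less_imp_le])
    qed auto
    also have "\<dots> = (\<Union>q\<in>\<rat> \<inter> {0..<r}. X -` cball x q \<inter> space M)" by auto
    also have "\<dots> \<in> sets M"
      by (intro sets.countable_UN' countable_Int1 countable_rat) (auto intro: cball_meas)
    finally show ?thesis .
  qed
  show ?thesis
  proof (rule borel_measurableI)
    fix U :: "'a set" assume "open U"
    then obtain \<B> where \<B>: "\<B> \<subseteq> case_prod ball ` (C \<times> (\<rat> \<inter> {0<..}))" "\<Union>\<B> = U"
      using C(1) by (auto simp: topological_basis_def)
    have "countable \<B>"
      using \<B>(1) by (rule countable_subset)
        (intro countable_image countable_SIGMA C countable_Int1 countable_rat)
    moreover have "X -` B \<inter> space M \<in> sets M" if "B \<in> \<B>" for B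
      using that \<B>(1) ball_meas by auto
    ultimately have "(\<Union>B\<in>\<B>. X -` B \<inter> space M) \<in> sets M"
      by (intro sets.countable_UN') auto
    also have "(\<Union>B\<in>\<B>. X -` B \<inter> space M) = X -` U \<inter> space M" using \<B>(2) by auto
    finally show "X -` U \<inter> space M \<in> sets M" .
  qed
qed


section \<open>Pointwise limits of Gaussian variables\<close>

text \<open>
  As affine images of the standard normal law, the normal laws include the point masses
  (\<open>\<sigma> = 0\<close>), so that limits of the parameters need no case distinction.
\<close>

definition normal_law :: "real \<Rightarrow> real \<Rightarrow> real measure" where
  "normal_law m \<sigma> = distr std_normal_distribution borel (\<lambda>x. m + \<sigma> * x)"

interpretation std_normal: real_distribution std_normal_distribution
  by (rule real_dist_normal_dist)

lemma normal_law_0: "normal_law m 0 = return borel m"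
  unfolding normal_law_def using std_normal.distr_const[of m borel] by simp

lemma normal_law_pos:
  assumes "\<sigma> > 0"
  shows "normal_law m \<sigma> = density lborel (normal_density m \<sigma>)"
proof -
  have "distributed std_normal_distribution lborel (\<lambda>x. x) std_normal_density"
    by (auto simp: distributed_def distr_id2)
  from std_normal.normal_density_affine[OF this, of \<sigma> m] assms
  have "distributed std_normal_distribution lborel (\<lambda>x. m + \<sigma> * x) (normal_density m \<sigma>)"
    by simp
  then show ?thesis
    by (simp add: normal_law_def distributed_def cong: distr_cong)
qed

lemma gaussian_real_iff_normal_law: "gaussian_real \<nu> \<longleftrightarrow> (\<exists>m \<sigma>. \<sigma> \<ge> 0 \<and> \<nu> = normal_law m \<sigma>)"
  unfolding gaussian_real_def
  by (metis less_eq_real_def normal_law_0 normal_law_pos)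

lemma char_normal_law:
  "char (normal_law m \<sigma>) t = iexp (t * m) * complex_of_real (exp (- ((\<sigma> * t)\<^sup>2) / 2))"
proof -
  have "char (normal_law m \<sigma>) t = (CLINT x|std_normal_distribution. iexp (t * m) * iexp ((t * \<sigma>) * x))"
    unfolding char_def normal_law_def
    by (subst integral_distr) (auto simp: exp_add[symmetric] algebra_simps)
  also have "\<dots> = iexp (t * m) * char std_normal_distribution (t * \<sigma>)"
    unfolding char_def by (rule integral_mult_right_zero)
  finally show ?thesis by (simp add: char_std_normal_distribution mult.commute)
qed

lemma real_distribution_normal_law: "real_distribution (normal_law m \<sigma>)"
  unfolding normal_law_def by (rule std_normal.real_distribution_distr) simp

text \<open>
  A large mean would rotate the characteristic function to a negative value at the small argument
  \<open>t = pi / m\<close>, and a large standard deviation would damp its modulus below \<open>1/2\<close> at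
  \<open>t = \<delta>\<close>; either keeps it away from \<open>1\<close>.
\<close>

lemma normal_law_bounded_parameters:
  assumes "\<delta> > 0" "\<sigma> \<ge> 0"
    and near: "\<And>t. \<bar>t\<bar> \<le> \<delta> \<Longrightarrow> cmod (char (normal_law m \<sigma>) t - 1) \<le> 1/2"
  shows "\<bar>m\<bar> \<le> pi / \<delta>" "\<sigma> \<le> 2 / \<delta>"
proof -
  show "\<bar>m\<bar> \<le> pi / \<delta>"
  proof (rule ccontr)
    assume m: "\<not> \<bar>m\<bar> \<le> pi / \<delta>"
    then have "m \<noteq> 0" using assms(1) by auto
    let ?e = "exp (- ((\<sigma> * (pi / m))\<^sup>2) / 2)"
    have "\<bar>pi / m\<bar> \<le> \<delta>" using m assms(1) \<open>m \<noteq> 0\<close> by (simp add: field_simps)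
    moreover have "char (normal_law m \<sigma>) (pi / m) - 1 = - complex_of_real (?e + 1)"
      using \<open>m \<noteq> 0\<close> by (simp add: char_normal_law)
    ultimately have "cmod (complex_of_real (?e + 1)) \<le> 1/2"
      using near by (metis norm_minus_cancel)
    then show False unfolding norm_of_real by (smt (verit) exp_gt_zero field_sum_of_halves)
  qed
  show "\<sigma> \<le> 2 / \<delta>"
  proof (rule ccontr)
    assume "\<not> \<sigma> \<le> 2 / \<delta>"
    then have "2\<^sup>2 < (\<sigma> * \<delta>)\<^sup>2"
      using assms(1) by (intro power_strict_mono) (auto simp: field_simps)
    then have "exp (- ((\<sigma> * \<delta>)\<^sup>2) / 2) < exp (-1 :: real)" by simp
    also have "\<dots> \<le> 1/2"
      using exp_ge_add_one_self[of 1] by (simp add: exp_minus field_simps)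
    finally have "cmod (char (normal_law m \<sigma>) \<delta>) < 1/2"
      by (simp add: char_normal_law norm_mult)
    moreover have "1 - cmod (char (normal_law m \<sigma>) \<delta>) \<le> cmod (char (normal_law m \<sigma>) \<delta> - 1)"
      using norm_triangle_ineq2[of 1 "char (normal_law m \<sigma>) \<delta>"] by (simp add: norm_minus_commute)
    ultimately show False using near[of \<delta>] assms(1) by simp
  qed
qed

text \<open>
  Pointwise boundedness yields one event of probability close to \<open>1\<close> on which all \<open>X n\<close> are
  bounded by the same \<open>K\<close>.  There \<open>exp (i t X)\<close> differs from \<open>1\<close> by at most \<open>\<bar>t\<bar> K\<close>,
  and elsewhere by at most \<open>2\<close>.
\<close>

lemma (in prob_space) char_equicontinuous_at_0:
  fixes X :: "nat \<Rightarrow> 'a \<Rightarrow> real"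
  assumes X[measurable]: "\<And>n. random_variable borel (X n)"
    and bdd: "\<And>\<omega>. \<omega> \<in> space M \<Longrightarrow> Bseq (\<lambda>n. X n \<omega>)"
    and \<epsilon>: "\<epsilon> > 0"
  shows "\<exists>\<delta>>0. \<forall>n t. \<bar>t\<bar> \<le> \<delta> \<longrightarrow> cmod (char (distr M borel (X n)) t - 1) \<le> \<epsilon>"
proof -
  define A where "A K = {\<omega>\<in>space M. \<forall>n. \<bar>X n \<omega>\<bar> \<le> real K}" for K
  have [measurable]: "A K \<in> sets M" for K unfolding A_def by measurable
  have "incseq A" by (auto simp: A_def incseq_def) (meson of_nat_mono order_trans)
  moreover have "(\<Union>K. A K) = space M"
  proof -
    have "\<exists>K. \<omega> \<in> A K" if \<omega>: "\<omega> \<in> space M" for \<omega>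
    proof -
      obtain c where "\<And>n. \<bar>X n \<omega>\<bar> \<le> c" using bdd[OF \<omega>] by (auto simp: Bseq_def)
      then show ?thesis using \<omega> real_nat_ceiling_ge[of c]
        by (auto simp: A_def intro!: exI[of _ "nat \<lceil>c\<rceil>"] intro: order_trans)
    qed
    then show ?thesis by (auto simp: A_def)
  qed
  moreover have "range A \<subseteq> events" by auto
  ultimately have "(\<lambda>K. prob (A K)) \<longlonglongrightarrow> 1"
    using finite_Lim_measure_incseq[of A] by (auto simp: prob_space)
  then have "eventually (\<lambda>K. prob (A K) > 1 - \<epsilon> / 4) sequentially"
    using \<epsilon> by (intro order_tendstoD) auto
  then obtain K where K: "prob (A K) > 1 - \<epsilon> / 4"
    by (auto simp: eventually_sequentially)
  define \<delta> where "\<delta> = \<epsilon> / (2 * (real K + 1))"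
  have \<delta>: "\<delta> > 0" using \<epsilon> by (simp add: \<delta>_def)
  have "cmod (char (distr M borel (X n)) t - 1) \<le> \<epsilon>" if t: "\<bar>t\<bar> \<le> \<delta>" for n t
  proof -
    have int: "integrable M (\<lambda>\<omega>. iexp (t * X n \<omega>))"
      by (intro integrable_iexp) auto
    have ind: "integrable M (indicat_real (space M - A K))"
      by (intro integrable_real_indicator) (auto simp: emeasure_eq_measure)
    have "char (distr M borel (X n)) t - 1 = (CLINT \<omega>|M. iexp (t * X n \<omega>) - 1)"
      unfolding char_def using int by (subst integral_distr) (auto simp: prob_space)
    also have "cmod \<dots> \<le> (LINT \<omega>|M. cmod (iexp (t * X n \<omega>) - 1))"
      by (rule integral_norm_bound)
    also have "\<dots> \<le> (LINT \<omega>|M. \<epsilon> / 2 + 2 * indicator (space M - A K) \<omega>)"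
    proof (rule integral_mono)
      show "integrable M (\<lambda>\<omega>. cmod (iexp (t * X n \<omega>) - 1))"
        using int by (intro integrable_norm Bochner_Integration.integrable_diff) auto
      show "integrable M (\<lambda>\<omega>. \<epsilon> / 2 + 2 * indicator (space M - A K) \<omega>)"
        by (intro Bochner_Integration.integrable_add integrable_mult_right ind) auto
      fix \<omega> assume \<omega>: "\<omega> \<in> space M"
      show "cmod (iexp (t * X n \<omega>) - 1) \<le> \<epsilon> / 2 + 2 * indicator (space M - A K) \<omega>"
      proof (cases "\<omega> \<in> A K")
        case True
        have "cmod (iexp (t * X n \<omega>) - 1) \<le> \<bar>t * X n \<omega>\<bar>"
          using iexp_approx1[of "t * X n \<omega>" 0] by simp
        also have "\<dots> \<le> \<delta> * (real K + 1)"
          unfolding abs_mult using True t \<delta>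
          by (intro mult_mono) (auto simp: A_def intro: order_trans)
        also have "\<dots> = \<epsilon> / 2" by (simp add: \<delta>_def field_simps)
        finally show ?thesis using True by simp
      next
        case False
        have "cmod (iexp (t * X n \<omega>) - 1) \<le> 2"
          using norm_triangle_ineq4[of "iexp (t * X n \<omega>)" 1] by simp
        then show ?thesis using False \<omega> \<epsilon> by simp
      qed
    qed
    also have "\<dots> = \<epsilon> / 2 + 2 * prob (space M - A K)"
      using ind by (subst Bochner_Integration.integral_add) (auto simp: prob_space)
    also have "\<dots> \<le> \<epsilon>" using K by (simp add: prob_compl)
    finally show ?thesis .
  qed
  then show ?thesis using \<delta> by blast
qed

text \<open>
  Compactness of the parameter rectangle provides a candidate limit law along a subsequence, and
  dominated convergence identifies its characteristic function with that of \<open>Y\<close>.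
\<close>

lemma (in prob_space) gaussian_real_pointwise_limit:
  fixes X :: "nat \<Rightarrow> 'a \<Rightarrow> real"
  assumes X[measurable]: "\<And>n. random_variable borel (X n)"
    and gauss: "\<And>n. gaussian_real (distr M borel (X n))"
    and lim: "\<And>\<omega>. \<omega> \<in> space M \<Longrightarrow> (\<lambda>n. X n \<omega>) \<longlonglongrightarrow> Y \<omega>"
  shows "gaussian_real (distr M borel Y)"
proof -
  have Y[measurable]: "random_variable borel Y"
    using lim X by (rule borel_measurable_LIMSEQ_real)
  have "\<forall>n. \<exists>m \<sigma>. \<sigma> \<ge> 0 \<and> distr M borel (X n) = normal_law m \<sigma>"
    using gauss by (simp add: gaussian_real_iff_normal_law)
  then obtain m \<sigma> where \<sigma>: "\<And>n. \<sigma> n \<ge> 0" and law: "\<And>n. distr M borel (X n) = normal_law (m n) (\<sigma> n)"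
    by metis
  obtain \<delta> where \<delta>: "\<delta> > 0"
    "\<And>n t. \<bar>t\<bar> \<le> \<delta> \<Longrightarrow> cmod (char (distr M borel (X n)) t - 1) \<le> 1/2"
    using char_equicontinuous_at_0[of X "1/2"] convergent_imp_Bseq lim
    by (auto simp: convergent_def)
  have bounds: "\<bar>m n\<bar> \<le> pi / \<delta>" "\<sigma> n \<le> 2 / \<delta>" for n
    using normal_law_bounded_parameters[of \<delta> "\<sigma> n" "m n"] \<delta> \<sigma> by (auto simp: law)
  have "(m n, \<sigma> n) \<in> {- (pi / \<delta>)..pi / \<delta>} \<times> {0..2 / \<delta>}" for n
    using bounds[of n] \<sigma>[of n] by (auto simp: abs_le_iff)
  moreover have "seq_compact ({- (pi / \<delta>)..pi / \<delta>} \<times> {0..2 / \<delta>})"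
    by (intro compact_imp_seq_compact compact_Times compact_Icc)
  ultimately obtain l r where l: "l \<in> {- (pi / \<delta>)..pi / \<delta>} \<times> {0..2 / \<delta>}"
    and r: "strict_mono r" and lr: "((\<lambda>n. (m n, \<sigma> n)) \<circ> r) \<longlonglongrightarrow> l"
    by (meson seq_compactE)
  obtain a s where as: "l = (a, s)" by (cases l)
  have ma: "(\<lambda>n. m (r n)) \<longlonglongrightarrow> a" and \<sigma>s: "(\<lambda>n. \<sigma> (r n)) \<longlonglongrightarrow> s"
    using tendsto_fst[OF lr] tendsto_snd[OF lr] by (simp_all add: as comp_def)
  have "char (distr M borel Y) t = char (normal_law a s) t" for t
  proof (rule LIMSEQ_unique)
    show "(\<lambda>n. char (distr M borel (X (r n))) t) \<longlonglongrightarrow> char (normal_law a s) t"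
      unfolding law char_normal_law by (intro tendsto_intros ma \<sigma>s) auto
    have "(\<lambda>n. CLINT \<omega>|M. iexp (t * X (r n) \<omega>)) \<longlonglongrightarrow> (CLINT \<omega>|M. iexp (t * Y \<omega>))"
    proof (rule integral_dominated_convergence[where w="\<lambda>_. 1"])
      show "AE \<omega> in M. (\<lambda>n. iexp (t * X (r n) \<omega>)) \<longlonglongrightarrow> iexp (t * Y \<omega>)"
      proof (rule AE_I2)
        fix \<omega> assume "\<omega> \<in> space M"
        from LIMSEQ_subseq_LIMSEQ[OF lim[OF this] r]
        have "(\<lambda>n. X (r n) \<omega>) \<longlonglongrightarrow> Y \<omega>" by (simp add: comp_def)
        then show "(\<lambda>n. iexp (t * X (r n) \<omega>)) \<longlonglongrightarrow> iexp (t * Y \<omega>)"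
          by (intro tendsto_intros)
      qed
    qed auto
    then show "(\<lambda>n. char (distr M borel (X (r n))) t) \<longlonglongrightarrow> char (distr M borel Y) t"
      by (simp add: char_def integral_distr)
  qed
  then have "distr M borel Y = normal_law a s"
    by (intro Levy_uniqueness real_distribution_normal_law real_distribution_distr Y) auto
  then show ?thesis using l as by (auto simp: gaussian_real_iff_normal_law)
qed

section \<open>The law of the path map\<close>

theorem theorem3:
  fixes M :: "'w measure"
    and D :: "'d::metric_space set"
    and app :: "'h::{real_inner,banach,second_countable_topology} \<Rightarrow> 'd \<Rightarrow> real"
    and Z :: "'w \<Rightarrow> 'd \<Rightarrow> real"
  assumes "compact D"
    and "rkhs D app"
    and "gaussian_process M D Z"
    and "\<And>\<omega>. \<omega> \<in> space M \<Longrightarrow> in_function_space D app (Z \<omega>)"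
  shows "path_map D app Z \<in> borel_measurable M \<and>
         gaussian_measure (distr M borel (path_map D app Z))"
proof -
  define \<Phi> where "\<Phi> = path_map D app Z"
  have rk: "\<And>s. s \<in> D \<Longrightarrow> linear (\<lambda>h. app h s)"
    "\<And>s. s \<in> D \<Longrightarrow> continuous_on UNIV (\<lambda>h. app h s)"
    "\<And>g h. (\<And>s. s \<in> D \<Longrightarrow> app g s = app h s) \<Longrightarrow> g = h"
    using assms(2) unfolding rkhs_def by blast+
  interpret prob_space M using assms(3) by (simp add: gaussian_process_def)
  have "\<forall>s\<in>D. \<exists>z. \<forall>h. app h s = inner z h"
    using ex_riesz_representer[OF rk(1) rk(2)] by blast
  then obtain k where k: "\<And>s h. s \<in> D \<Longrightarrow> app h s = inner (k s) h" by metis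
  have dense: "closure (span (k ` D)) = UNIV"
  proof (rule dense_span_if_separating)
    fix w assume w: "\<And>b. b \<in> k ` D \<Longrightarrow> inner b w = 0"
    show "w = 0"
      by (rule rk(3)) (simp add: k w)
  qed
  have eval: "inner (k s) (\<Phi> \<omega>) = Z \<omega> s" if "\<omega> \<in> space M" "s \<in> D" for \<omega> s
    using path_map_eval[of D app Z \<omega> s] assms(2) assms(4) that k by (simp add: \<Phi>_def)
  have comb: "(\<lambda>\<omega>. inner z (\<Phi> \<omega>)) \<in> borel_measurable M \<and>
      gaussian_real (distr M borel (\<lambda>\<omega>. inner z (\<Phi> \<omega>)))" if z: "z \<in> span (k ` D)" for z
  proof -
    obtain n c s where s: "\<And>i. i < n \<Longrightarrow> s i \<in> D" and zs: "z = (\<Sum>i<(n::nat). c i *\<^sub>R k (s i))"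
      using span_image_finite_sum[OF z] by blast
    have eq: "inner z (\<Phi> \<omega>) = (\<Sum>i<n. c i * Z \<omega> (s i))" if "\<omega> \<in> space M" for \<omega>
      using s that by (simp add: zs inner_sum_left eval)
    have gv: "gaussian_vector M n (\<lambda>i \<omega>. Z \<omega> (s i))"
      using assms(3) s by (simp add: gaussian_process_def)
    then have "(\<lambda>\<omega>. \<Sum>i<n. c i * Z \<omega> (s i)) \<in> borel_measurable M"
      unfolding gaussian_vector_def by (intro borel_measurable_sum borel_measurable_times) auto
    moreover have "distr M borel (\<lambda>\<omega>. inner z (\<Phi> \<omega>)) = distr M borel (\<lambda>\<omega>. \<Sum>i<n. c i * Z \<omega> (s i))"
      by (rule distr_cong) (auto simp: eq)
    moreover have "(\<lambda>\<omega>. inner z (\<Phi> \<omega>)) \<in> borel_measurable M \<longleftrightarrow>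
        (\<lambda>\<omega>. \<Sum>i<n. c i * Z \<omega> (s i)) \<in> borel_measurable M"
      by (rule measurable_cong) (rule eq)
    ultimately show ?thesis using gv by (simp add: gaussian_vector_def)
  qed
  have inner: "(\<lambda>\<omega>. inner z (\<Phi> \<omega>)) \<in> borel_measurable M"
    "gaussian_real (distr M borel (\<lambda>\<omega>. inner z (\<Phi> \<omega>)))" for z
  proof -
    obtain y where y: "\<And>n. y n \<in> span (k ` D)" "y \<longlonglongrightarrow> z"
      using dense UNIV_I[of z]
      by (metis closure_sequential)
    have lim: "(\<lambda>n. inner (y n) (\<Phi> \<omega>)) \<longlonglongrightarrow> inner z (\<Phi> \<omega>)" for \<omega>
      by (intro tendsto_intros y)
    show "(\<lambda>\<omega>. inner z (\<Phi> \<omega>)) \<in> borel_measurable M"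
      by (rule borel_measurable_LIMSEQ_real[OF lim]) (use comb y in blast)
    show "gaussian_real (distr M borel (\<lambda>\<omega>. inner z (\<Phi> \<omega>)))"
      by (rule gaussian_real_pointwise_limit[OF _ _ lim]) (use comb y in blast)+
  qed
  have \<Phi>[measurable]: "\<Phi> \<in> borel_measurable M"
    by (rule borel_measurable_if_inner_measurable) (rule inner)
  have "gaussian_real (distr (distr M borel \<Phi>) borel l)" if l: "bounded_linear l" for l :: "'h \<Rightarrow> real"
  proof -
    have cont: "continuous_on UNIV l" by (rule linear_continuous_on[OF l])
    then obtain z where z: "\<And>x. l x = inner z x"
      using ex_riesz_representer[OF bounded_linear.linear[OF l]] by blast
    have "l \<in> borel_measurable borel" using cont by (rule borel_measurable_continuous_onI)
    then have "distr (distr M borel \<Phi>) borel l = distr M borel (\<lambda>\<omega>. inner z (\<Phi> \<omega>))"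
      by (subst distr_distr) (auto simp: comp_def z)
    then show ?thesis using inner by simp
  qed
  then show ?thesis
    using \<Phi> prob_space_distr[OF \<Phi>] by (simp add: gaussian_measure_def \<Phi>_def)
qed

end
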